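(* Let $m\geq 1$ and $x\geq 1$ be natural numbers. Then: (i) if $x$ is not of the form $p^c-1$ for any prime $p$ dividing $m$ and any integer $c\geq 1$, then $\ell(m,x+1)=\ell(m,x)$; (ii) if $x=p^c-1$ for some prime $p$ dividing $m$ and some integer $c\geq 1$, then $\ell(m,x+1)=p\,\ell(m,x)$.
   Context: For natural numbers $m\geq 1$ and $x\geq 1$, $\ell(m,x)$ denotes the minimal period modulo $m$ of the sequence $n\mapsto\binom{n}{x}$, that is, the least non-zero natural number $\ell$ such that $\binom{n+\ell}{x}\equiv\binom{n}{x}\pmod m$ for all positive integers $n$, with the convention $\binom{n}{x}=0$ if $0\leq n<x$ and $\binom{n}{x}=\frac{n!}{x!(n-x)!}$ if $n\geq x$. The paper recalls as known that if $m=\prod_{i=1}^w p_i^{b_i}$ is the factorization of $m$ into powers of distinct primes ($b_i\geq 1$), then $\ell(m,x)=m\prod_{i=1}^w p_i^{\lfloor\log_{p_i}x\rfloor}$. *)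

theory Defs
  imports "HOL-Number_Theory.Number_Theory"
begin

(* The LEAST is over a nonempty set whenever m >= 1: a nonzero period exists for every x.
   The library's binomial coefficient already satisfies (n choose x) = 0 for n < x. *)
definition binom_period :: "nat \<Rightarrow> nat \<Rightarrow> nat" where
  "binom_period m x =
     (LEAST l. l > 0 \<and> (\<forall>n\<ge>1. [(n + l) choose x = n choose x] (mod m)))"

end

theory Submission
  imports Defs
begin

text \<open>
  By Pascal's rule, \<open>l\<close> is a period of \<open>n \<mapsto> n choose x\<close> modulo \<open>m\<close> iff \<open>m\<close> divides
  \<open>l choose j\<close> for all \<open>1 \<le> j \<le> x\<close>. From \<open>j * (l choose j) = l * ((l - 1) choose (j - 1))\<close>
  this holds for a prime power \<open>p ^ b\<close> iff \<open>p ^ (b + k)\<close> divides \<open>l\<close>, where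
  \<open>p ^ k \<le> x < p ^ (k + 1)\<close>; the binding indices are the powers \<open>j = p ^ i\<close>, for which
  \<open>(l - 1) choose (p ^ i - 1)\<close> is prime to \<open>p\<close>. Hence the period is
  \<open>m\<close> times the product of \<open>p ^ k\<close> over the primes \<open>p\<close> dividing \<open>m\<close>, and \<open>k\<close> changes
  between \<open>x\<close> and \<open>x + 1\<close> exactly when \<open>x + 1\<close> is a power of \<open>p\<close>.
\<close>

section \<open>Divisibility of binomial coefficients by powers of one prime\<close>

lemma prime_power_dvd_choose:
  fixes p b k l j :: nat
  assumes "prime p" "p ^ (b + k) dvd l" "1 \<le> j" "j < p ^ (k + 1)"
  shows "p ^ b dvd l choose j"
proof (cases "l = 0")
  case True
  then show ?thesis using assms by (cases j) auto
next
  case False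
  define i where "i = multiplicity p j"
  have "p ^ i dvd j" by (simp add: i_def multiplicity_dvd)
  then have "p ^ i \<le> j" using assms(3) by (simp add: dvd_imp_le)
  also note assms(4)
  finally have "i < k + 1"
    using power_less_imp_less_exp prime_gt_1_nat[OF assms(1)] by blast
  then have "i \<le> k" by simp
  obtain r where r: "j = p ^ i * r" "\<not> p dvd r"
    unfolding i_def using assms(1,3) multiplicity_decompose'[of j p] by (metis not_one_le_zero not_prime_unit)
  \<comment> \<open>At least \<open>b + k\<close> factors \<open>p\<close> divide the right-hand
    side, and \<open>j\<close> absorbs only \<open>i \<le> k\<close> of them, so at least
    \<open>b\<close> remain for \<open>l choose j\<close>.\<close>
  have "j * (l choose j) = l * ((l - 1) choose (j - 1))"
    using False assms(3) Suc_times_binomial[of "j - 1" "l - 1"] by simp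
  then have "p ^ (b + k) dvd p ^ i * (r * (l choose j))"
    using assms(2) r(1) by (metis dvd_mult2 mult.assoc)
  then have "p ^ i * p ^ (b + k - i) dvd p ^ i * (r * (l choose j))"
    using \<open>i \<le> k\<close> by (simp flip: power_add)
  then have "p ^ (b + k - i) dvd r * (l choose j)"
    using assms(1) by (simp add: prime_gt_0_nat)
  moreover have "coprime (p ^ (b + k - i)) r"
    using r(2) assms(1) by (simp add: prime_imp_coprime)
  ultimately have "p ^ (b + k - i) dvd l choose j"
    by (simp add: coprime_dvd_mult_right_iff)
  then show ?thesis using \<open>i \<le> k\<close>
    by (meson add_le_imp_le_diff add_le_cancel_left dvd_trans le_imp_power_dvd)
qed

text \<open>Modulo \<open>p\<close>, Pascal's rule makes neighbouring entries of row
  \<open>l - 1\<close> negatives of each other, because the entry of row \<open>l\<close> below them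
  vanishes as long as its index is less than \<open>p ^ k\<close>. The row starts with 1, so these
  entries are all units.\<close>

lemma prime_not_dvd_choose_pred:
  fixes p k l j :: nat
  assumes "prime p" "p ^ k dvd l" "l > 0" "j < p ^ k"
  shows "\<not> p dvd (l - 1) choose j"
  using assms(4)
proof (induction j)
  case 0
  then show ?case using assms(1) by auto
next
  case (Suc j)
  then obtain k' where k: "k = Suc k'" by (cases k) auto
  have "p ^ 1 dvd l choose (Suc j)"
    by (rule prime_power_dvd_choose[where k = k']) (use assms Suc.prems k in auto)
  then have "p dvd l choose (Suc j)" by simp
  also have "l choose (Suc j) = ((l - 1) choose j) + ((l - 1) choose (Suc j))"
    using assms(3) by (metis Suc_diff_1 binomial_Suc_Suc)
  finally have "p dvd ((l - 1) choose j) + ((l - 1) choose (Suc j))" .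
  moreover have "\<not> p dvd (l - 1) choose j" using Suc by simp
  ultimately show ?case using dvd_add_left_iff by blast
qed

lemma prime_power_dvd_all_choose_iff:
  fixes p b k l x :: nat
  assumes p: "prime p" and "b \<ge> 1" "p ^ k \<le> x" "x < p ^ (k + 1)"
  shows "(\<forall>j\<in>{1..x}. p ^ b dvd l choose j) \<longleftrightarrow> p ^ (b + k) dvd l"
proof
  assume "p ^ (b + k) dvd l"
  then show "\<forall>j\<in>{1..x}. p ^ b dvd l choose j"
    using assms prime_power_dvd_choose by (metis atLeastAtMost_iff le_less_trans)
next
  assume *: "\<forall>j\<in>{1..x}. p ^ b dvd l choose j"
  \<comment> \<open>The exponent is raised one at a time: index 1 gives \<open>p ^ b\<close>, and
    each further index \<open>p ^ Suc i\<close> gives one more factor \<open>p\<close>.\<close>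
  have "i \<le> k \<Longrightarrow> p ^ (b + i) dvd l" for i
  proof (induction i)
    case 0
    have "1 \<in> {1..x}" using assms by (meson atLeastAtMost_iff le_refl le_trans one_le_power prime_ge_1_nat)
    with * have "p ^ b dvd l choose 1" by blast
    then show ?case by simp
  next
    case (Suc i)
    show ?case
    proof (cases "l = 0")
      case False
      define j where "j = p ^ Suc i"
      have j: "j \<ge> 1" using p by (simp add: j_def prime_gt_0_nat Suc_leI)
      have "j \<le> x"
        using Suc.prems assms(3) power_increasing[of "Suc i" k p] p prime_ge_1_nat
        unfolding j_def by fastforce
      with * j have "p ^ b dvd l choose j" by simp
      then have "p ^ (b + Suc i) dvd j * (l choose j)"
        unfolding j_def by (simp add: power_add mult.commute mult_dvd_mono)
      also have "j * (l choose j) = l * ((l - 1) choose (j - 1))"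
        using False j Suc_times_binomial[of "j - 1" "l - 1"] by simp
      finally have "p ^ (b + Suc i) dvd l * ((l - 1) choose (j - 1))" .
      \<comment> \<open>As \<open>b \<ge> 1\<close>, the induction hypothesis already provides this
        power, which is what makes the cofactor of \<open>l\<close> prime to
        \<open>p\<close>.\<close>
      moreover have "p ^ Suc i dvd l"
        using Suc \<open>b \<ge> 1\<close> by (intro dvd_trans[OF le_imp_power_dvd[of "Suc i" "b + i"]]) simp_all
      then have "\<not> p dvd (l - 1) choose (j - 1)"
        using prime_not_dvd_choose_pred[OF p, of "Suc i" l "j - 1"] False j unfolding j_def by simp
      then have "coprime (p ^ (b + Suc i)) ((l - 1) choose (j - 1))"
        using p by (simp add: prime_imp_coprime)
      ultimately show ?thesis by (simp add: coprime_dvd_mult_left_iff)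
    qed simp
  qed
  then show "p ^ (b + k) dvd l" by simp
qed

section \<open>Combining the primes that divide \<open>m\<close>\<close>

lemma prod_dvd_iff_pairwise_coprime:
  fixes f :: "'a \<Rightarrow> nat"
  assumes "finite A" "\<And>i j. i \<in> A \<Longrightarrow> j \<in> A \<Longrightarrow> i \<noteq> j \<Longrightarrow> coprime (f i) (f j)"
  shows "prod f A dvd a \<longleftrightarrow> (\<forall>i\<in>A. f i dvd a)"
  using assms
proof (induction A rule: finite_induct)
  case (insert i A)
  have "coprime (f i) (prod f A)"
    using insert by (intro prod_coprime_right) auto
  then have "f i * prod f A dvd a \<longleftrightarrow> f i dvd a \<and> prod f A dvd a"
    by (meson divides_mult dvd_mult_left dvd_mult_right)
  then show ?case using insert by simp
qed simp

lemma prod_prime_powers_dvd_iff: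
  fixes A :: "nat set" and e :: "nat \<Rightarrow> nat"
  assumes "finite A" "\<And>p. p \<in> A \<Longrightarrow> prime p"
  shows "(\<Prod>p\<in>A. p ^ e p) dvd a \<longleftrightarrow> (\<forall>p\<in>A. p ^ e p dvd a)"
  using assms by (intro prod_dvd_iff_pairwise_coprime) (auto simp: primes_coprime)

lemma nat_floor_log_bounds:
  fixes p x :: nat
  assumes "prime p" "x \<ge> 1"
  shows "p ^ nat \<lfloor>log p x\<rfloor> \<le> x" "x < p ^ (nat \<lfloor>log p x\<rfloor> + 1)"
proof -
  have p: "p \<ge> 2" using assms(1) by (rule prime_ge_2_nat)
  \<comment> \<open>The logarithm is nonnegative since \<open>x \<ge> 1\<close>, so
    \<open>nat\<close> truncates nothing.\<close>
  then have "\<lfloor>log p x\<rfloor> = int (nat \<lfloor>log p x\<rfloor>)"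
    using assms(2) by simp
  then show "p ^ nat \<lfloor>log p x\<rfloor> \<le> x" "x < p ^ (nat \<lfloor>log p x\<rfloor> + 1)"
    using floor_log_nat_eq_powr_iff[OF p] assms(2) by (metis less_le_trans zero_less_one)+
qed

text \<open>Splitting \<open>m\<close> into prime powers and exchanging the quantifiers over primes
  and indices lets the criterion for a single prime act separately on each \<open>p\<close>.\<close>

lemma dvd_all_choose_iff:
  fixes m x l :: nat
  assumes "m \<ge> 1" "x \<ge> 1"
  shows "(\<forall>j\<in>{1..x}. m dvd l choose j) \<longleftrightarrow>
    m * (\<Prod>p\<in>prime_factors m. p ^ nat \<lfloor>log p x\<rfloor>) dvd l"
proof -
  define e where "e p = nat \<lfloor>log p x\<rfloor>" for p :: nat
  define L where "L = m * (\<Prod>p\<in>prime_factors m. p ^ e p)"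
  have L: "L = (\<Prod>p\<in>prime_factors m. p ^ (multiplicity p m + e p))"
    using assms(1) prime_factorization_nat[of m] by (simp add: L_def power_add prod.distrib)
  have m_dvd: "m dvd a \<longleftrightarrow> (\<forall>p\<in>prime_factors m. p ^ multiplicity p m dvd a)" for a
    using prod_prime_powers_dvd_iff[of "prime_factors m" "\<lambda>p. multiplicity p m" a]
      prime_factorization_nat[of m] assms(1) by auto
  have e: "p ^ e p \<le> x" "x < p ^ (e p + 1)" if "prime p" for p
    using nat_floor_log_bounds[OF that assms(2)] by (simp_all add: e_def)
  have "(\<forall>j\<in>{1..x}. m dvd l choose j) \<longleftrightarrow>
      (\<forall>p\<in>prime_factors m. \<forall>j\<in>{1..x}. p ^ multiplicity p m dvd l choose j)"
    unfolding m_dvd by blast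
  also have "\<dots> \<longleftrightarrow> (\<forall>p\<in>prime_factors m. p ^ (multiplicity p m + e p) dvd l)"
    using e assms(1)
    by (intro ball_cong refl prime_power_dvd_all_choose_iff)
      (auto simp: prime_factors_multiplicity)
  also have "\<dots> \<longleftrightarrow> L dvd l"
    unfolding L by (rule prod_prime_powers_dvd_iff[symmetric]) auto
  finally show ?thesis by (simp add: L_def e_def)
qed

section \<open>From periods to divisibility, and the period formula\<close>

lemma choose_period_iff:
  fixes m x l :: nat
  shows "(\<forall>n. [(n + l) choose x = n choose x] (mod m)) \<longleftrightarrow> (\<forall>j\<in>{1..x}. m dvd l choose j)"
proof (induction x)
  case 0
  then show ?case by simp
next
  case (Suc x)
  \<comment> \<open>Differencing in \<open>n\<close> lowers the index from \<open>Suc x\<close> to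
    \<open>x\<close>, and the constant lost in this way is fixed by the value at
    \<open>n = 0\<close>. This is why \<open>n = 0\<close> is included here, unlike in
    \<open>binom_period\<close>.\<close>
  have "(\<forall>n. [(n + l) choose Suc x = n choose Suc x] (mod m)) \<longleftrightarrow>
      (\<forall>n. [(n + l) choose x = n choose x] (mod m)) \<and> m dvd l choose Suc x" (is "?P \<longleftrightarrow> ?Q \<and> ?R")
  proof (intro iffI conjI)
    assume P: ?P
    show ?Q
    proof
      fix n
      have "[((n + l) choose x) + ((n + l) choose Suc x) = (n choose x) + (n choose Suc x)] (mod m)"
        using P[rule_format, of "Suc n"] by simp
      then show "[(n + l) choose x = n choose x] (mod m)"
        using cong_add[OF cong_refl[of "(n + l) choose x"] P[rule_format, of n]]
        by (metis cong_add_rcancel_nat cong_sym cong_trans)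
    qed
    show ?R using P[rule_format, of 0] by (simp add: cong_0_iff)
  next
    assume QR: "?Q \<and> ?R"
    show ?P
    proof
      fix n
      show "[(n + l) choose Suc x = n choose Suc x] (mod m)"
      proof (induction n)
        case 0
        then show ?case using QR by (simp add: cong_0_iff)
      next
        case (Suc n)
        then show ?case using QR by (simp add: cong_add)
      qed
    qed
  qed
  also have "\<dots> \<longleftrightarrow> (\<forall>j\<in>{1..Suc x}. m dvd l choose j)"
    using Suc.IH by (simp add: atLeastAtMostSuc_conv conj_commute)
  finally show ?case .
qed

theorem binom_period_eq:
  fixes m x :: nat
  assumes "m \<ge> 1" "x \<ge> 1"
  shows "binom_period m x = m * (\<Prod>p\<in>prime_factors m. p ^ nat \<lfloor>log p x\<rfloor>)"
proof -
  define L where "L = m * (\<Prod>p\<in>prime_factors m. p ^ nat \<lfloor>log p x\<rfloor>)"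
  have iff: "(\<forall>n. [(n + l) choose x = n choose x] (mod m)) \<longleftrightarrow> L dvd l" for l
    unfolding L_def choose_period_iff by (rule dvd_all_choose_iff[OF assms])
  have "L > 0"
    using assms(1) unfolding L_def by (auto simp: prod_pos intro!: prod_pos prime_gt_0_nat)
  have *: "(\<forall>n\<ge>1. [(n + l) choose x = n choose x] (mod m)) \<longleftrightarrow> L dvd l" for l
  proof
    assume l: "\<forall>n\<ge>1. [(n + l) choose x = n choose x] (mod m)"
    \<comment> \<open>The case \<open>n = 0\<close> follows by shifting by the genuine period \<open>L\<close>.\<close>
    have L: "[(n + L) choose x = n choose x] (mod m)" for n
      using iff[of L] by simp
    have "[(0 + l) choose x = (L + l) choose x] (mod m)"
      using L[of l] by (simp add: cong_sym add.commute)
    also have "[(L + l) choose x = L choose x] (mod m)" using l \<open>L > 0\<close> by simp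
    also have "[L choose x = 0 choose x] (mod m)" using L[of 0] by simp
    finally have "[(n + l) choose x = n choose x] (mod m)" for n
      using l by (cases "n = 0") auto
    then show "L dvd l" using iff by blast
  qed (use iff in blast)
  show ?thesis
    unfolding binom_period_def * L_def[symmetric]
    using \<open>L > 0\<close> by (intro Least_equality) (auto simp: dvd_imp_le)
qed

section \<open>Passing from \<open>x\<close> to \<open>x + 1\<close>\<close>

lemma nat_floor_log_Suc:
  fixes p x :: nat
  assumes "prime p" "x \<ge> 1"
  shows "nat \<lfloor>log p (real (x + 1))\<rfloor> =
    (if \<exists>c\<ge>1. x = p ^ c - 1 then nat \<lfloor>log p x\<rfloor> + 1 else nat \<lfloor>log p x\<rfloor>)"
proof -
  define k where "k = nat \<lfloor>log p x\<rfloor>"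
  have p: "p \<ge> 2" using assms(1) by (rule prime_ge_2_nat)
  have k: "p ^ k \<le> x" "x < p ^ (k + 1)"
    unfolding k_def by (rule nat_floor_log_bounds[OF assms])+
  show ?thesis
  \<comment> \<open>\<open>x + 1\<close> is at most \<open>p ^ (k + 1)\<close>, and the logarithm
    jumps only on equality. Otherwise \<open>x + 1\<close> lies strictly between consecutive powers
    of \<open>p\<close>.\<close>
  proof (cases "x + 1 = p ^ (k + 1)")
    case True
    have "p ^ (k + 1) < p ^ (k + 1 + 1)" using p by simp
    with True have "\<lfloor>log p (real (x + 1))\<rfloor> = int (k + 1)"
      using floor_log_nat_eq_if[of p "k + 1" "x + 1"] p by simp
    moreover have "x = p ^ (k + 1) - 1" using True by simp
    then have "\<exists>c\<ge>1. x = p ^ c - 1" by (metis le_add2)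
    ultimately show ?thesis unfolding k_def by (simp only: nat_int if_True)
  next
    case False
    have "x \<noteq> p ^ c - 1" for c
    proof
      assume "x = p ^ c - 1"
      then have c: "x + 1 = p ^ c" using p by simp
      then have "p ^ k < p ^ c" "p ^ c < p ^ (k + 1)" using k False by linarith+
      then have "k < c" "c < k + 1"
        using power_less_imp_less_exp[of p] prime_gt_1_nat[OF assms(1)] by blast+
      then show False by simp
    qed
    moreover have "\<lfloor>log p (real (x + 1))\<rfloor> = int k"
      using k False p by (intro floor_log_nat_eq_if) auto
    ultimately show ?thesis by (simp add: k_def)
  qed
qed

theorem corollary2p9:
  fixes m x :: nat
  assumes "m \<ge> 1" and "x \<ge> 1"
  shows "(\<not> (\<exists>p c :: nat. prime p \<and> p dvd m \<and> c \<ge> 1 \<and> x = p ^ c - 1) \<longrightarrow>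
            binom_period m (x + 1) = binom_period m x) \<and>
         (\<forall>p c :: nat. prime p \<and> p dvd m \<and> c \<ge> 1 \<and> x = p ^ c - 1 \<longrightarrow>
            binom_period m (x + 1) = p * binom_period m x)"
proof (intro conjI impI allI)
  assume *: "\<not> (\<exists>p c :: nat. prime p \<and> p dvd m \<and> c \<ge> 1 \<and> x = p ^ c - 1)"
  have "(\<Prod>q\<in>prime_factors m. q ^ nat \<lfloor>log q (real (x + 1))\<rfloor>) =
      (\<Prod>q\<in>prime_factors m. q ^ nat \<lfloor>log q x\<rfloor>)"
  proof (intro prod.cong refl)
    fix q assume "q \<in> prime_factors m"
    then have q: "prime q" "\<not> (\<exists>c\<ge>1. x = q ^ c - 1)" using * by auto
    then show "q ^ nat \<lfloor>log q (real (x + 1))\<rfloor> = q ^ nat \<lfloor>log q x\<rfloor>"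
      using nat_floor_log_Suc[OF q(1) assms(2)] by (simp only: q(2) if_False)
  qed
  then show "binom_period m (x + 1) = binom_period m x"
    using assms by (simp add: binom_period_eq)
next
  fix p c :: nat
  assume pc: "prime p \<and> p dvd m \<and> c \<ge> 1 \<and> x = p ^ c - 1"
  then have p: "p \<in> prime_factors m" using assms(1) by (auto simp: in_prime_factors_iff)
  have log_p: "nat \<lfloor>log p (real (x + 1))\<rfloor> = nat \<lfloor>log p x\<rfloor> + 1"
    using nat_floor_log_Suc[of p x] pc assms(2) by auto
  have "(\<Prod>q\<in>prime_factors m - {p}. q ^ nat \<lfloor>log q (real (x + 1))\<rfloor>) =
      (\<Prod>q\<in>prime_factors m - {p}. q ^ nat \<lfloor>log q x\<rfloor>)"
  proof (intro prod.cong refl)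
    fix q assume q: "q \<in> prime_factors m - {p}"
    \<comment> \<open>\<open>x + 1\<close> cannot be a power of two different primes, so only the
      factor at \<open>p\<close> changes. With \<open>x \<ge> 1\<close> the truncated subtraction
      can be undone.\<close>
    have "x \<noteq> q ^ d - 1" for d
    proof
      assume "x = q ^ d - 1"
      then have "p ^ c = q ^ d" using pc assms(2) by linarith
      then have "p dvd q ^ d" using pc by (metis dvd_power less_le_trans zero_less_one)
      then have "p = q"
        using pc q by (meson DiffD1 in_prime_factors_imp_prime prime_dvd_power primes_dvd_imp_eq)
      then show False using q by simp
    qed
    then show "q ^ nat \<lfloor>log q (real (x + 1))\<rfloor> = q ^ nat \<lfloor>log q x\<rfloor>"
      using nat_floor_log_Suc[OF in_prime_factors_imp_prime assms(2), of q m] q by simp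
  qed
  then have "(\<Prod>q\<in>prime_factors m. q ^ nat \<lfloor>log q (real (x + 1))\<rfloor>) =
      p * (\<Prod>q\<in>prime_factors m. q ^ nat \<lfloor>log q x\<rfloor>)"
    using log_p by (simp add: prod.remove[OF _ p])
  then show "binom_period m (x + 1) = p * binom_period m x"
    using assms by (simp add: binom_period_eq)
qed

end
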